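(* Let $(\Omega,\Omega^\Omega,\mathcal B_\Omega,\mathsf P)$ be the universal Hilbert cube, i.e. $\Omega:=[0,1]^{\mathbb N}$ with Borel $\sigma$-algebra $\mathcal B_\otimes=\bigotimes_{n\in\mathbb N}\mathcal B_{[0,1]}$, $\mathcal B_\Omega:=(\mathcal B_\otimes)_{\mathsf G}$ the $\sigma$-algebra of all universally measurable subsets of $\Omega$, $\Omega^\Omega$ the set of all measurable maps $(\Omega,\mathcal B_\Omega)\to(\Omega,\mathcal B_\Omega)$, and $\mathsf P$ the set of all probability measures on $(\Omega,\mathcal B_\Omega)$. Then: 1. $(\Omega,\Omega^\Omega,\mathcal B_\Omega,\mathsf P)$ is a sample space with product-compatible probability measures; 2. it satisfies the Fubini property, and there is an isomorphism of quasi-measurable spaces $\Omega\cong\Omega\times\Omega$; 3. $(\Omega,\mathcal B_\Omega)$ is countably separated, every $P\in\mathsf P$ is perfect, and $\mathcal B_\Omega$ is $\mathsf P(\Omega)$-complete; 4. $\mathcal F(\mathcal B_\otimes)=\mathcal F(\mathcal B_\Omega)=\Omega^\Omega$ and $\mathcal B_{\Omega\times\Omega}=(\mathcal B_\Omega\otimes\mathcal B_\Omega)_{\mathsf P(\Omega\times\Omega)}$.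
   Context: For a set $\mathcal Q\neq\emptyset$ of probability measures whose domains contain the $\sigma$-algebra $\mathcal B$, the $\mathcal Q$-completion is $(\mathcal B)_{\mathcal Q}:=\bigcap_{Q\in\mathcal Q}(\mathcal B)_Q$, where $(\mathcal B)_Q$ is the Lebesgue completion of $\mathcal B$ w.r.t. $Q|_{\mathcal B}$; $\mathcal B$ is $\mathcal Q$-complete if $\mathcal B=(\mathcal B)_{\mathcal Q}$. The universal completion $(\mathcal B)_{\mathsf G}$ is the completion with respect to all probability measures on $\mathcal B$. For a $\sigma$-algebra $\mathcal B$ on $\mathcal X$, $\mathcal F(\mathcal B)$ is the set of all measurable maps $(\Omega,\mathcal B_\Omega)\to(\mathcal X,\mathcal B)$. Sample space with product-compatible probability measures $(\Omega,\Omega^\Omega,\mathcal B_\Omega,\mathsf P)$: $\Omega\neq\emptyset$; $\Omega^\Omega$ is a set of maps $\Omega\to\Omega$ containing the identity and all constants and closed under composition; every $\Phi\in\Omega^\Omega$ is $\mathcal B_\Omega$-$\mathcal B_\Omega$-measurable; $\mathsf P$ is a non-empty set of probability measures $P$ on $\Omega$, with domain $\sigma$-algebras $\mathcal B_P$, such that (i) $\Phi^{-1}(D)\in\mathcal B_P$ for all $\Phi\in\Omega^\Omega$, $P\in\mathsf P$, $D\in\mathcal B_\Omega$; (ii) for $D\in\mathcal B_{\Omega\times\Omega}$, $P\in\mathsf P$ the map $\omega\mapsto P(D^\omega)$ is $\mathcal B_\Omega$-measurable; (iii) for $P_1,P_2\in\mathsf P$ there are $P\in\mathsf P$ and $\Phi=(\Phi_1,\Phi_2)$,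 $\Phi_i\in\Omega^\Omega$, with $\int P_1(D^{\omega_2})P_2(d\omega_2)=P(\Phi^{-1}(D))$ for all $D\in\mathcal B_{\Omega\times\Omega}$. Here $D^{\omega_2}=\{\omega_1\mid(\omega_1,\omega_2)\in D\}$, $D_{\omega_1}=\{\omega_2\mid(\omega_1,\omega_2)\in D\}$, and $\mathcal B_{\Omega\times\Omega}=\{D\subseteq\Omega\times\Omega\mid(\Phi_1,\Phi_2)^{-1}(D)\in\mathcal B_\Omega\ \forall\Phi_1,\Phi_2\in\Omega^\Omega\}$. Fubini property: $\int P_2(D_{\omega_1})P_1(d\omega_1)=\int P_1(D^{\omega_2})P_2(d\omega_2)$ for all $P_1,P_2\in\mathsf P$, $D\in\mathcal B_{\Omega\times\Omega}$. An isomorphism of quasi-measurable spaces $\Omega\cong\Omega\times\Omega$ is a bijection $\Theta$ with $\Theta\circ\Omega^\Omega=\Omega^\Omega\times\Omega^\Omega$ (pairs of maps in $\Omega^\Omega$ viewed as maps into $\Omega\times\Omega$). $\mathsf P(\Omega)$ is the set of push-forwards $\Phi_*P$ on $\mathcal B_\Omega$, $P\in\mathsf P$, $\Phi\in\Omega^\Omega$; $\mathsf P(\Omega\times\Omega)$ is the set of push-forwards $(\Phi_1,\Phi_2)_*P$ on $\mathcal B_{\Omega\times\Omega}$. $(\Omega,\mathcal B_\Omega)$ is countably separated if some countable subset of $\mathcal B_\Omega$ separates the points of $\Omega$. A probability measure $P$ on $(\Omega,\mathcal B_\Omega)$ is perfect if for every measurable $f:\Omega\to\mathbb R$ there is a Borel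 set $B\subseteq f(\Omega)$ with $P(f^{-1}(B))=1$. *)

theory Defs
  imports "HOL-Probability.Probability"
begin

text \<open>
  A \<open>\<sigma>\<close>-algebra on a set is given by a value \<open>B :: 'a measure\<close> of which only
  \<open>space B\<close> and \<open>sets B\<close> matter. Maps between carrier sets are represented by
  functions that are \<open>extensional\<close> on the domain, so that equality of sets of maps is the
  intended one.
\<close>

section \<open>Completions\<close>

text \<open>
  Each \<open>Q\<close> is first restricted to \<open>B\<close> and then Lebesgue completed. Under the standing
  assumptions the intersection already is a \<open>\<sigma>\<close>-algebra (\<open>sets_Q_completion\<close> below),
  so that \<open>sigma\<close> only serves to package it.
\<close>

definition Q_completion :: "'a measure \<Rightarrow> 'a measure set \<Rightarrow> 'a measure" where
  "Q_completion B Qs =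
     sigma (space B) (\<Inter>Q\<in>Qs. sets (completion (restr_to_subalg Q B)))"

lemma space_Q_completion [simp]: "space (Q_completion B Qs) = space B"
  by (simp add: Q_completion_def space_measure_of_conv)

lemma sets_Q_completion:
  assumes "Qs \<noteq> {}" and "\<And>Q. Q \<in> Qs \<Longrightarrow> subalgebra Q B"
  shows "sets (Q_completion B Qs) = (\<Inter>Q\<in>Qs. sets (completion (restr_to_subalg Q B)))"
proof -
  have sp: "space (completion (restr_to_subalg Q B)) = space B" if "Q \<in> Qs" for Q
    using assms(2)[OF that] by (simp add: subalgebra_def space_restr_to_subalg)
  have "sigma_algebra (space B) (sets (completion (restr_to_subalg Q B)))" if "Q \<in> Qs" for Q
    using sets.sigma_algebra_axioms[of "completion (restr_to_subalg Q B)"] sp[OF that] by simp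
  then have "sigma_algebra (space B) (\<Inter>Q\<in>Qs. sets (completion (restr_to_subalg Q B)))"
    using assms(1) unfolding sigma_algebra_iff2 by blast
  then show ?thesis
    unfolding Q_completion_def by (rule sigma_algebra.sets_measure_of_eq)
qed

definition Q_complete :: "'a measure \<Rightarrow> 'a measure set \<Rightarrow> bool" where
  "Q_complete B Qs \<longleftrightarrow> sets B = sets (Q_completion B Qs)"

definition all_probs :: "'a measure \<Rightarrow> 'a measure set" where
  "all_probs B = {Q. prob_space Q \<and> sets Q = sets B}"

definition universal_completion :: "'a measure \<Rightarrow> 'a measure" where
  "universal_completion B = Q_completion B (all_probs B)"

section \<open>Maps and the product\<close>

definition meas_maps :: "'a measure \<Rightarrow> 'b measure \<Rightarrow> ('a \<Rightarrow> 'b) set" where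
  "meas_maps A B = (A \<rightarrow>\<^sub>M B) \<inter> extensional (space A)"

definition pair_map :: "'w set \<Rightarrow> ('w \<Rightarrow> 'a) \<Rightarrow> ('w \<Rightarrow> 'b) \<Rightarrow> 'w \<Rightarrow> 'a \<times> 'b" where
  "pair_map W f g = (\<lambda>\<omega>\<in>W. (f \<omega>, g \<omega>))"

text \<open>In the following \<open>B\<close> is \<open>\<B>\<^sub>\<Omega>\<close>, \<open>F\<close> is \<open>\<Omega>\<^sup>\<Omega>\<close>, and \<open>Ps\<close> is the set of
  probability measures. Sections and integrals are taken in \<open>ennreal\<close>; all values lie in \<open>[0,1]\<close>.\<close>

definition square_sets :: "'w measure \<Rightarrow> ('w \<Rightarrow> 'w) set \<Rightarrow> ('w \<times> 'w) set set" where
  "square_sets B F = {D. D \<subseteq> space B \<times> space B \<and>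
     (\<forall>\<Phi>1\<in>F. \<forall>\<Phi>2\<in>F. pair_map (space B) \<Phi>1 \<Phi>2 -` D \<inter> space B \<in> sets B)}"

definition square_space :: "'w measure \<Rightarrow> ('w \<Rightarrow> 'w) set \<Rightarrow> ('w \<times> 'w) measure" where
  "square_space B F = sigma (space B \<times> space B) (square_sets B F)"

lemma sets_square_space:
  assumes "F \<subseteq> space B \<rightarrow> space B"
  shows "sets (square_space B F) = square_sets B F"
proof -
  have "sigma_algebra (space B \<times> space B) (square_sets B F)"
    unfolding sigma_algebra_iff2
  proof (intro conjI ballI allI impI)
    show "square_sets B F \<subseteq> Pow (space B \<times> space B)" and "{} \<in> square_sets B F"
      by (auto simp: square_sets_def)
  next
    fix D assume D: "D \<in> square_sets B F"
    have "pair_map (space B) f g -` (space B \<times> space B - D) \<inter> space B \<in> sets B"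
      if "f \<in> F" "g \<in> F" for f g
    proof -
      have "pair_map (space B) f g -` (space B \<times> space B - D) \<inter> space B
          = space B - (pair_map (space B) f g -` D \<inter> space B)"
        using that assms by (auto simp: pair_map_def Pi_iff subset_iff)
      then show ?thesis using D that by (auto simp: square_sets_def)
    qed
    then show "space B \<times> space B - D \<in> square_sets B F" by (auto simp: square_sets_def)
  next
    fix A :: "nat \<Rightarrow> ('a \<times> 'a) set" assume A: "range A \<subseteq> square_sets B F"
    have "pair_map (space B) f g -` (\<Union>i. A i) \<inter> space B \<in> sets B"
      if "f \<in> F" "g \<in> F" for f g
    proof -
      have "pair_map (space B) f g -` (\<Union>i. A i) \<inter> space B
          = (\<Union>i. pair_map (space B) f g -` A i \<inter> space B)" by auto
      moreover have "pair_map (space B) f g -` A i \<inter> space B \<in> sets B" for i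
        using A that by (auto simp: square_sets_def subset_iff)
      ultimately show ?thesis by (metis (no_types, lifting) sets.countable_nat_UN image_subsetI)
    qed
    then show "\<Union> (range A) \<in> square_sets B F" using A by (fastforce simp: square_sets_def)
  qed
  then show ?thesis
    unfolding square_space_def by (rule sigma_algebra.sets_measure_of_eq)
qed

section \<open>Sample spaces\<close>

locale sample_space =
  fixes B :: "'w measure" and F :: "('w \<Rightarrow> 'w) set" and Ps :: "'w measure set"
  assumes nonempty: "space B \<noteq> {}"
    and maps_ext: "F \<subseteq> space B \<rightarrow>\<^sub>E space B"
    and maps_id: "(\<lambda>\<omega>\<in>space B. \<omega>) \<in> F"
    and maps_const: "\<And>c. c \<in> space B \<Longrightarrow> (\<lambda>\<omega>\<in>space B. c) \<in> F"
    and maps_comp: "\<And>\<Phi> \<Psi>. \<Phi> \<in> F \<Longrightarrow> \<Psi> \<in> F \<Longrightarrow> compose (space B) \<Phi> \<Psi> \<in> F"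
    and maps_meas: "\<And>\<Phi>. \<Phi> \<in> F \<Longrightarrow> \<Phi> \<in> B \<rightarrow>\<^sub>M B"
    and probs_nonempty: "Ps \<noteq> {}"
    and probs: "\<And>P. P \<in> Ps \<Longrightarrow> prob_space P \<and> space P = space B"
    and preimages: "\<And>\<Phi> P D. \<Phi> \<in> F \<Longrightarrow> P \<in> Ps \<Longrightarrow> D \<in> sets B \<Longrightarrow>
          \<Phi> -` D \<inter> space B \<in> sets P"
    and sections: "\<And>D P. D \<in> square_sets B F \<Longrightarrow> P \<in> Ps \<Longrightarrow>
          (\<lambda>\<omega>. emeasure P {\<omega>1. (\<omega>1, \<omega>) \<in> D}) \<in> borel_measurable B"
    and products: "\<And>P1 P2. P1 \<in> Ps \<Longrightarrow> P2 \<in> Ps \<Longrightarrow>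
          \<exists>P\<in>Ps. \<exists>\<Phi>1\<in>F. \<exists>\<Phi>2\<in>F. \<forall>D\<in>square_sets B F.
            (\<integral>\<^sup>+ \<omega>2. emeasure P1 {\<omega>1. (\<omega>1, \<omega>2) \<in> D} \<partial>P2)
              = emeasure P (pair_map (space B) \<Phi>1 \<Phi>2 -` D \<inter> space B)"

definition fubini :: "'w measure \<Rightarrow> ('w \<Rightarrow> 'w) set \<Rightarrow> 'w measure set \<Rightarrow> bool" where
  "fubini B F Ps \<longleftrightarrow> (\<forall>P1\<in>Ps. \<forall>P2\<in>Ps. \<forall>D\<in>square_sets B F.
     (\<integral>\<^sup>+ \<omega>1. emeasure P2 {\<omega>2. (\<omega>1, \<omega>2) \<in> D} \<partial>P1)
       = (\<integral>\<^sup>+ \<omega>2. emeasure P1 {\<omega>1. (\<omega>1, \<omega>2) \<in> D} \<partial>P2))"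

definition square_iso :: "'w set \<Rightarrow> ('w \<Rightarrow> 'w) set \<Rightarrow> ('w \<Rightarrow> 'w \<times> 'w) \<Rightarrow> bool" where
  "square_iso W F \<Theta> \<longleftrightarrow> bij_betw \<Theta> W (W \<times> W) \<and>
     {compose W \<Theta> \<Phi> |\<Phi>. \<Phi> \<in> F} = {pair_map W \<Phi>1 \<Phi>2 |\<Phi>1 \<Phi>2. \<Phi>1 \<in> F \<and> \<Phi>2 \<in> F}"

definition push_probs :: "'w measure \<Rightarrow> ('w \<Rightarrow> 'w) set \<Rightarrow> 'w measure set \<Rightarrow> 'w measure set" where
  "push_probs B F Ps = {distr P B \<Phi> |P \<Phi>. P \<in> Ps \<and> \<Phi> \<in> F}"

definition push_probs_square ::
    "'w measure \<Rightarrow> ('w \<Rightarrow> 'w) set \<Rightarrow> 'w measure set \<Rightarrow> ('w \<times> 'w) measure set" where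
  "push_probs_square B F Ps =
     {distr P (square_space B F) (pair_map (space B) \<Phi>1 \<Phi>2) |P \<Phi>1 \<Phi>2.
        P \<in> Ps \<and> \<Phi>1 \<in> F \<and> \<Phi>2 \<in> F}"

definition countably_separated :: "'w measure \<Rightarrow> bool" where
  "countably_separated B \<longleftrightarrow> (\<exists>\<C>. countable \<C> \<and> \<C> \<subseteq> sets B \<and>
     (\<forall>x\<in>space B. \<forall>y\<in>space B. x \<noteq> y \<longrightarrow> (\<exists>C\<in>\<C>. (x \<in> C) \<noteq> (y \<in> C))))"

definition perfect :: "'w measure \<Rightarrow> bool" where
  "perfect P \<longleftrightarrow> (\<forall>f \<in> borel_measurable P. \<exists>S \<in> sets (borel :: real measure).
     S \<subseteq> f ` space P \<and> emeasure P (f -` S \<inter> space P) = 1)"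

section \<open>The universal Hilbert cube\<close>

definition cube_borel :: "(nat \<Rightarrow> real) measure" where
  "cube_borel = (\<Pi>\<^sub>M n\<in>UNIV. restrict_space borel {0..1})"

definition cube :: "(nat \<Rightarrow> real) measure" where
  "cube = universal_completion cube_borel"

definition cube_maps :: "((nat \<Rightarrow> real) \<Rightarrow> (nat \<Rightarrow> real)) set" where
  "cube_maps = meas_maps cube cube"

definition cube_probs :: "(nat \<Rightarrow> real) measure set" where
  "cube_probs = all_probs cube"

end

theory Submission
  imports Defs
begin

text \<open>
  A set is universally measurable iff for each Borel probability measure it is sandwiched between two
  Borel sets that differ by a null set. Hence a map from a universally completed space into a
  Borel space stays measurable when the target is universally completed too. Since the cube is Borel
  isomorphic to its square, by splitting a sequence into its even and odd coordinates, the family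
  \<open>square_sets cube cube_maps\<close> consists exactly of the universally measurable sets. Measurability of section
  measures, products and the Fubini property then follow by sandwiching from the Borel case.
\<close>

section \<open>Universal completion\<close>

text \<open>Two mismatches shape the proof. The measures in \<open>cube_probs\<close> live on the
  completed \<sigma>-algebra, while the universal completion of the square is tested by measures on
  the Borel product only. So every measure is cut down to the Borel sets by
  \<open>restr_to_subalg\<close>, products are formed there by Tonelli's theorem, and the results
  are carried back by completing. Moreover a sandwich depends on the measure: if one pair of Borel
  sets served all of them, point masses would force both to coincide with the given set. Hence
  measurability is checked one measure at a time, and \<open>universal_completion_closed\<close>
  collects the answers even when the measures tested live on the completed \<sigma>-algebra.\<close>

lemma sets_completion_iff_sandwich:
  "A \<in> sets (completion M) \<longleftrightarrow>
     (\<exists>L\<in>sets M. \<exists>U\<in>sets M. L \<subseteq> A \<and> A \<subseteq> U \<and> emeasure M (U - L) = 0)"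
proof
  assume "A \<in> sets (completion M)"
  then obtain S N N' where *: "A = S \<union> N" "N \<subseteq> N'" "N' \<in> null_sets M" "S \<in> sets M"
    by (rule sets_completionE)
  \<comment> \<open>\<open>S \<union> N'\<close> serves as the upper set. The two-sided form is
    preferred to the decomposition \<open>S \<union> N\<close> because preimages and sections
    preserve inclusions.\<close>
  have "emeasure M (S \<union> N' - S) \<le> emeasure M N'"
    using * by (intro emeasure_mono) auto
  then have "emeasure M (S \<union> N' - S) = 0"
    using * by auto
  then show "\<exists>L\<in>sets M. \<exists>U\<in>sets M. L \<subseteq> A \<and> A \<subseteq> U \<and> emeasure M (U - L) = 0"
    using * by (intro bexI[of _ S] bexI[of _ "S \<union> N'"]) auto
next
  assume "\<exists>L\<in>sets M. \<exists>U\<in>sets M. L \<subseteq> A \<and> A \<subseteq> U \<and> emeasure M (U - L) = 0"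
  then obtain L U where "L \<in> sets M" "U \<in> sets M" "L \<subseteq> A" "A \<subseteq> U" "emeasure M (U - L) = 0"
    by blast
  then show "A \<in> sets (completion M)"
    by (intro sets_completionI[of A L "A - L" "U - L"]) auto
qed

text \<open>A completed measure already contains all subsets of its null sets, so the part
  \<open>A - L\<close> between the two bounds is measurable.\<close>

lemma sets_completion_completion: "sets (completion (completion M)) = sets (completion M)"
proof (intro subset_antisym subsetI)
  fix A assume "A \<in> sets (completion (completion M))"
  then obtain L U where "L \<in> sets (completion M)" "U \<in> sets (completion M)" "L \<subseteq> A" "A \<subseteq> U"
      "emeasure (completion M) (U - L) = 0"
    unfolding sets_completion_iff_sandwich[of A "completion M"] by blast
  then have "A - L \<in> null_sets (completion M)"
    by (intro null_sets_completion_subset[of "A - L" "U - L"] null_setsI sets.Diff) auto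
  then have "L \<union> (A - L) \<in> sets (completion M)"
    using \<open>L \<in> sets (completion M)\<close> by blast
  moreover have "L \<union> (A - L) = A" using \<open>L \<subseteq> A\<close> by blast
  ultimately show "A \<in> sets (completion M)" by simp
qed simp

text \<open>The target carries the image measure because for it the null set \<open>U - L\<close>
  has a null preimage, so the preimages of \<open>L\<close> and \<open>U\<close> again form a
  sandwich.\<close>

lemma vimage_in_completion:
  assumes f: "f \<in> M \<rightarrow>\<^sub>M N" and A: "A \<in> sets (completion (distr M N f))"
  shows "f -` A \<inter> space M \<in> sets (completion M)"
proof -
  obtain L U where *: "L \<in> sets N" "U \<in> sets N" "L \<subseteq> A" "A \<subseteq> U" "emeasure (distr M N f) (U - L) = 0"
    using A by (auto simp: sets_completion_iff_sandwich)
  have "(f -` U \<inter> space M) - (f -` L \<inter> space M) = f -` (U - L) \<inter> space M"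
    by auto
  then have "emeasure M ((f -` U \<inter> space M) - (f -` L \<inter> space M)) = 0"
    using * f by (simp add: emeasure_distr)
  moreover have "f -` L \<inter> space M \<subseteq> f -` A \<inter> space M" "f -` A \<inter> space M \<subseteq> f -` U \<inter> space M"
    using *(3,4) by auto
  ultimately show ?thesis
    unfolding sets_completion_iff_sandwich
    by (intro bexI[OF _ measurable_sets[OF f *(1)]] bexI[OF _ measurable_sets[OF f *(2)]] conjI)
qed

lemma restr_to_subalg_cong_sets: "sets Q = sets M \<Longrightarrow> restr_to_subalg Q M = Q"
  using measure_of_of_measure[of Q] by (simp add: restr_to_subalg_def)

lemma all_probs_nonempty:
  assumes "space M \<noteq> {}" shows "all_probs M \<noteq> {}"
proof -
  obtain c where "c \<in> space M" using assms by auto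
  then have "return M c \<in> all_probs M"
    by (simp add: all_probs_def prob_space_return)
  then show ?thesis by auto
qed

lemma space_universal_completion [simp]: "space (universal_completion M) = space M"
  by (simp add: universal_completion_def)

text \<open>On an empty space there is no probability measure, and the right-hand side would hold
  for every \<open>A\<close>; hence the assumption.\<close>

lemma sets_universal_completion:
  assumes "space M \<noteq> {}"
  shows "A \<in> sets (universal_completion M) \<longleftrightarrow>
    (\<forall>Q. prob_space Q \<longrightarrow> sets Q = sets M \<longrightarrow> A \<in> sets (completion Q))"
proof -
  have "sets (universal_completion M)
      = (\<Inter>Q\<in>all_probs M. sets (completion (restr_to_subalg Q M)))"
    unfolding universal_completion_def
    using all_probs_nonempty[OF assms]
    by (intro sets_Q_completion) (auto simp: all_probs_def subalgebra_def dest: sets_eq_imp_space_eq)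
  also have "\<dots> = (\<Inter>Q\<in>all_probs M. sets (completion Q))"
    by (auto simp: all_probs_def restr_to_subalg_cong_sets)
  finally show ?thesis
    by (simp add: all_probs_def) blast
qed

lemma sets_universal_completion_subset_completion:
  assumes "prob_space Q" "sets Q = sets M"
  shows "sets (universal_completion M) \<subseteq> sets (completion Q)"
proof -
  have "space M \<noteq> {}"
    using prob_space.not_empty[OF assms(1)] sets_eq_imp_space_eq[OF assms(2)] by simp
  then show ?thesis using assms by (simp add: subset_iff sets_universal_completion)
qed

lemma sets_subset_universal_completion:
  "space M \<noteq> {} \<Longrightarrow> sets M \<subseteq> sets (universal_completion M)"
  by (simp add: subset_iff sets_universal_completion)

lemma subalgebra_universal_completion:
  assumes "space M \<noteq> {}" "P \<in> all_probs (universal_completion M)"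
  shows "subalgebra P M"
  using assms sets_subset_universal_completion[of M] sets_eq_imp_space_eq[of P "universal_completion M"]
  by (auto simp: all_probs_def subalgebra_def)

lemma universal_completion_in_completion_restr:
  assumes "prob_space P" "subalgebra P M" "A \<in> sets (universal_completion M)"
  shows "A \<in> sets (completion (restr_to_subalg P M))"
  using sets_universal_completion_subset_completion[of "restr_to_subalg P M" M] assms
  by (auto simp: prob_space_restr_to_subalg sets_restr_to_subalg)

text \<open>Every probability measure on \<open>M\<close> extends, via its Lebesgue completion, to the universal
  completion; so completing a second time adds nothing.\<close>

lemma universal_completion_closed:
  assumes M: "space M \<noteq> {}"
    and A: "\<And>P. P \<in> all_probs (universal_completion M) \<Longrightarrow> A \<in> sets (completion P)"
  shows "A \<in> sets (universal_completion M)"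
  unfolding sets_universal_completion[OF M]
proof (intro allI impI)
  fix Q assume Q: "prob_space Q" "sets Q = sets M"
  let ?U = "universal_completion M"
  define P where "P = restr_to_subalg (completion Q) ?U"
  have sub: "subalgebra (completion Q) ?U"
    using sets_universal_completion_subset_completion[OF Q] sets_eq_imp_space_eq[OF Q(2)]
    by (simp add: subalgebra_def)
  have "P \<in> all_probs ?U"
    unfolding P_def all_probs_def using sub prob_space.prob_space_completion[OF Q(1)]
    by (simp add: sets_restr_to_subalg prob_space_restr_to_subalg)
  from A[OF this] obtain L U where *: "L \<in> sets ?U" "U \<in> sets ?U" "L \<subseteq> A" "A \<subseteq> U"
      "emeasure (completion Q) (U - L) = 0"
    unfolding P_def sets_completion_iff_sandwich
    by (auto simp: sub sets_restr_to_subalg emeasure_restr_to_subalg simp del: emeasure_completion)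
  \<comment> \<open>\<open>L\<close> and \<open>U\<close> are only universally measurable, so they
    form a sandwich for the completion of \<open>Q\<close> rather than for \<open>Q\<close>;
    idempotence of completion closes the gap.\<close>
  then have "A \<in> sets (completion (completion Q))"
    unfolding sets_completion_iff_sandwich[of A "completion Q"]
    using sub unfolding subalgebra_def by blast
  then show "A \<in> sets (completion Q)"
    by (simp add: sets_completion_completion)
qed

text \<open>The target can be completed because each \<open>P\<close> on the completed source pushes
  forward to a probability measure on \<open>N\<close>. The set \<open>A\<close> is measurable for
  the completion of that image measure, so its preimage is measurable for the completion of
  \<open>P\<close>; this holds for all \<open>P\<close>.\<close>

lemma measurable_universal_completion:
  assumes f: "f \<in> universal_completion M \<rightarrow>\<^sub>M N" and M: "space M \<noteq> {}"
  shows "f \<in> universal_completion M \<rightarrow>\<^sub>M universal_completion N"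
proof (rule measurableI)
  fix x assume "x \<in> space (universal_completion M)"
  then show "f x \<in> space (universal_completion N)"
    using measurable_space[OF f] by simp
next
  fix A assume A: "A \<in> sets (universal_completion N)"
  show "f -` A \<inter> space (universal_completion M) \<in> sets (universal_completion M)"
  proof (rule universal_completion_closed[OF M])
    fix P assume P: "P \<in> all_probs (universal_completion M)"
    then have sp: "prob_space P" "sets P = sets (universal_completion M)"
        "space P = space (universal_completion M)"
      by (auto simp: all_probs_def dest: sets_eq_imp_space_eq)
    have f': "f \<in> P \<rightarrow>\<^sub>M N"
      using f by (simp add: measurable_cong_sets[OF sp(2) refl])
    have "A \<in> sets (completion (distr P N f))"
      using sets_universal_completion_subset_completion[of "distr P N f" N] A
        prob_space.prob_space_distr[OF sp(1) f'] by auto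
    from vimage_in_completion[OF f' this]
    show "f -` A \<inter> space (universal_completion M) \<in> sets (completion P)"
      by (simp only: sp(3))
  qed
qed

lemma measurable_universal_completion_mono:
  assumes "f \<in> M \<rightarrow>\<^sub>M N" "space M \<noteq> {}"
  shows "f \<in> universal_completion M \<rightarrow>\<^sub>M universal_completion N"
proof (rule measurable_universal_completion[OF _ assms(2)])
  show "f \<in> universal_completion M \<rightarrow>\<^sub>M N"
    using assms sets_subset_universal_completion[of M] measurable_mono[of N N M "universal_completion M"]
    by auto
qed

section \<open>Sections of universally measurable sets\<close>

text \<open>Tonelli's theorem for measures defined on more than \<open>M1\<close> and
  \<open>M2\<close>. The sections of \<open>L\<close> and their measures are measurable over the
  smaller \<sigma>-algebras, so restriction changes neither the section measures nor the integrals.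
  The restricted product \<open>R\<close> has exactly the sets of
  \<open>M1 \<Otimes>\<^sub>M M2\<close>, which makes it one of the test measures for the universal
  completion.\<close>

lemma emeasure_pair_restr_sections:
  assumes P1: "prob_space P1" "subalgebra P1 M1" and P2: "prob_space P2" "subalgebra P2 M2"
    and L: "L \<in> sets (M1 \<Otimes>\<^sub>M M2)"
  defines "R \<equiv> restr_to_subalg P1 M1 \<Otimes>\<^sub>M restr_to_subalg P2 M2"
  shows "(\<integral>\<^sup>+ y. emeasure P1 {x. (x, y) \<in> L} \<partial>P2) = emeasure R L"
    and "(\<integral>\<^sup>+ x. emeasure P2 {y. (x, y) \<in> L} \<partial>P1) = emeasure R L"
proof -
  let ?P1 = "restr_to_subalg P1 M1" and ?P2 = "restr_to_subalg P2 M2"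
  note [measurable_cong] = sets_restr_to_subalg[OF P1(2)] sets_restr_to_subalg[OF P2(2)]
  interpret R: pair_prob_space ?P1 ?P2
    using P1 P2 by (simp add: pair_prob_space_def pair_sigma_finite_def prob_space_restr_to_subalg
        prob_space_imp_sigma_finite)
  have sR: "sets R = sets (M1 \<Otimes>\<^sub>M M2)"
    unfolding R_def by (intro sets_pair_measure_cong sets_restr_to_subalg P1 P2)
  have LR: "L \<in> sets (?P1 \<Otimes>\<^sub>M ?P2)"
    using L sR by (simp add: R_def)
  have v1: "(\<lambda>x. (x, y)) -` L = {x. (x, y) \<in> L}" for y by auto
  have v2: "Pair x -` L = {y. (x, y) \<in> L}" for x by auto
  have m1: "{x. (x, y) \<in> L} \<in> sets M1" for y
    using sets_Pair2[OF L, of y] by (simp add: v1)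
  have m2: "{y. (x, y) \<in> L} \<in> sets M2" for x
    using sets_Pair1[OF L, of x] by (simp add: v2)
  have e1: "emeasure ?P1 {x. (x, y) \<in> L} = emeasure P1 {x. (x, y) \<in> L}" for y
    by (rule emeasure_restr_to_subalg[OF P1(2) m1])
  have e2: "emeasure ?P2 {y. (x, y) \<in> L} = emeasure P2 {y. (x, y) \<in> L}" for x
    by (rule emeasure_restr_to_subalg[OF P2(2) m2])
  have b1: "(\<lambda>y. emeasure P1 {x. (x, y) \<in> L}) \<in> borel_measurable M2"
    using R.measurable_emeasure_Pair2[OF LR] unfolding v1 e1
    by (rule measurable_in_subalg'[OF P2(2)])
  have b2: "(\<lambda>x. emeasure P2 {y. (x, y) \<in> L}) \<in> borel_measurable M1"
    using R.measurable_emeasure_Pair1[OF LR] unfolding v2 e2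
    by (rule measurable_in_subalg'[OF P1(2)])
  show "(\<integral>\<^sup>+ y. emeasure P1 {x. (x, y) \<in> L} \<partial>P2) = emeasure R L"
    using R.emeasure_pair_measure_alt2[OF LR] unfolding v1 e1 R_def
    by (simp add: nn_integral_subalgebra2[OF P2(2) b1])
  show "(\<integral>\<^sup>+ x. emeasure P2 {y. (x, y) \<in> L} \<partial>P1) = emeasure R L"
    using R.M2.emeasure_pair_measure_alt[OF LR] unfolding v2 e2 R_def
    by (simp add: nn_integral_subalgebra2[OF P1(2) b2])
qed

lemma emeasure_completion_sandwich:
  assumes "L \<in> sets M" "U \<in> sets M" "L \<subseteq> A" "A \<subseteq> U" "emeasure M (U - L) = 0"
  shows "emeasure (completion M) A = emeasure M L" and "emeasure M U = emeasure M L"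
proof -
  have "L \<union> (U - L) = U" using assms by auto
  then show eq: "emeasure M U = emeasure M L"
    using assms emeasure_Un_null_set[of L M "U - L"] by auto
  have A: "A \<in> sets (completion M)"
    using assms by (auto simp: sets_completion_iff_sandwich)
  show "emeasure (completion M) A = emeasure M L"
  proof (rule antisym)
    show "emeasure (completion M) A \<le> emeasure M L"
      using emeasure_mono[of A U "completion M"] assms eq by (simp del: emeasure_completion add: main_part)
        (metis main_part emeasure_completion sets_completionI_sets)
    show "emeasure M L \<le> emeasure (completion M) A"
      using emeasure_mono[of L A "completion M"] assms A
      by (metis main_part emeasure_completion sets_completionI_sets)
  qed
qed

text \<open>The integral for \<open>D\<close> is squeezed between those for \<open>L\<close> and
  \<open>U\<close>, which agree. \<open>nn_integral\<close> is monotone for arbitrary integrands, so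
  the squeeze works before the section measure of \<open>D\<close> is known to be measurable. The
  sections of \<open>D\<close> must be measurable, though: \<open>emeasure\<close> is 0 outside the
  \<sigma>-algebra, which could break the lower bound.\<close>

lemma nn_integral_sections_universal_completion:
  assumes P1: "prob_space P1" "subalgebra P1 M1" and P2: "prob_space P2" "subalgebra P2 M2"
    and D: "D \<in> sets (universal_completion (M1 \<Otimes>\<^sub>M M2))"
  defines "R \<equiv> restr_to_subalg P1 M1 \<Otimes>\<^sub>M restr_to_subalg P2 M2"
  shows "(\<And>y. {x. (x, y) \<in> D} \<in> sets P1) \<Longrightarrow>
      (\<integral>\<^sup>+ y. emeasure P1 {x. (x, y) \<in> D} \<partial>P2) = emeasure (completion R) D"
    and "(\<And>x. {y. (x, y) \<in> D} \<in> sets P2) \<Longrightarrow>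
      (\<integral>\<^sup>+ x. emeasure P2 {y. (x, y) \<in> D} \<partial>P1) = emeasure (completion R) D"
proof -
  have sR: "sets R = sets (M1 \<Otimes>\<^sub>M M2)"
    unfolding R_def by (intro sets_pair_measure_cong sets_restr_to_subalg P1 P2)
  have "prob_space R"
    unfolding R_def using P1 P2 by (intro prob_space_pair prob_space_restr_to_subalg)
  then have "D \<in> sets (completion R)"
    using sets_universal_completion_subset_completion sR D by blast
  then obtain L U where *: "L \<in> sets R" "U \<in> sets R" "L \<subseteq> D" "D \<subseteq> U" "emeasure R (U - L) = 0"
    by (auto simp: sets_completion_iff_sandwich)
  note e = emeasure_completion_sandwich[OF *]
  have LU: "L \<in> sets (M1 \<Otimes>\<^sub>M M2)" "U \<in> sets (M1 \<Otimes>\<^sub>M M2)"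
    using * sR by auto
  note L = emeasure_pair_restr_sections[OF P1 P2 LU(1), folded R_def]
  note U = emeasure_pair_restr_sections[OF P1 P2 LU(2), folded R_def]
  have U1: "{x. (x, y) \<in> U} \<in> sets P1" for y
    using sets_Pair2[OF LU(2), of y] P1(2) by (auto simp: vimage_def subalgebra_def)
  have U2: "{y. (x, y) \<in> U} \<in> sets P2" for x
    using sets_Pair1[OF LU(2), of x] P2(2) by (auto simp: vimage_def subalgebra_def)
  {
    assume D1: "\<And>y. {x. (x, y) \<in> D} \<in> sets P1"
    have "(\<integral>\<^sup>+ y. emeasure P1 {x. (x, y) \<in> L} \<partial>P2) \<le> (\<integral>\<^sup>+ y. emeasure P1 {x. (x, y) \<in> D} \<partial>P2)"
      using * D1 by (intro nn_integral_mono emeasure_mono) auto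
    moreover have "(\<integral>\<^sup>+ y. emeasure P1 {x. (x, y) \<in> D} \<partial>P2) \<le> (\<integral>\<^sup>+ y. emeasure P1 {x. (x, y) \<in> U} \<partial>P2)"
      using * U1 by (intro nn_integral_mono emeasure_mono) auto
    ultimately show "(\<integral>\<^sup>+ y. emeasure P1 {x. (x, y) \<in> D} \<partial>P2) = emeasure (completion R) D"
      unfolding L(1) U(1) e by (rule antisym[rotated])
  }
  {
    assume D2: "\<And>x. {y. (x, y) \<in> D} \<in> sets P2"
    have "(\<integral>\<^sup>+ x. emeasure P2 {y. (x, y) \<in> L} \<partial>P1) \<le> (\<integral>\<^sup>+ x. emeasure P2 {y. (x, y) \<in> D} \<partial>P1)"
      using * D2 by (intro nn_integral_mono emeasure_mono) auto
    moreover have "(\<integral>\<^sup>+ x. emeasure P2 {y. (x, y) \<in> D} \<partial>P1) \<le> (\<integral>\<^sup>+ x. emeasure P2 {y. (x, y) \<in> U} \<partial>P1)"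
      using * U2 by (intro nn_integral_mono emeasure_mono) auto
    ultimately show "(\<integral>\<^sup>+ x. emeasure P2 {y. (x, y) \<in> D} \<partial>P1) = emeasure (completion R) D"
      unfolding L(2) U(2) e by (rule antisym[rotated])
  }
qed

text \<open>For each \<open>Q\<close> on \<open>M2\<close> a sandwich of \<open>D\<close> is chosen
  with respect to the product with \<open>Q\<close>. The section measures of \<open>D\<close> and
  \<open>L\<close> may differ for some \<open>y\<close>, but only on a \<open>Q\<close>-null set,
  and the completion of \<open>Q\<close> tolerates such a change.\<close>

lemma measurable_emeasure_section_universal_completion:
  assumes P: "prob_space P" "subalgebra P M1" and M2: "space M2 \<noteq> {}"
    and D: "D \<in> sets (universal_completion (M1 \<Otimes>\<^sub>M M2))"
    and D1: "\<And>y. {x. (x, y) \<in> D} \<in> sets P"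
  shows "(\<lambda>y. emeasure P {x. (x, y) \<in> D}) \<in> borel_measurable (universal_completion M2)"
proof -
  let ?h = "\<lambda>y. emeasure P {x. (x, y) \<in> D}"
  have h: "?h \<in> borel_measurable (completion Q)" if Q: "prob_space Q" "sets Q = sets M2" for Q
  proof -
    let ?P = "restr_to_subalg P M1"
    let ?R = "?P \<Otimes>\<^sub>M Q"
    interpret R: pair_prob_space ?P Q
      using P Q by (simp add: pair_prob_space_def pair_sigma_finite_def prob_space_restr_to_subalg
          prob_space_imp_sigma_finite)
    have sR: "sets ?R = sets (M1 \<Otimes>\<^sub>M M2)"
      by (intro sets_pair_measure_cong sets_restr_to_subalg P Q)
    have "D \<in> sets (completion ?R)"
      using sets_universal_completion_subset_completion[OF R.prob_space_axioms sR] D by blast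
    then obtain L U where *: "L \<in> sets ?R" "U \<in> sets ?R" "L \<subseteq> D" "D \<subseteq> U" "emeasure ?R (U - L) = 0"
      by (auto simp: sets_completion_iff_sandwich)
    have v: "{x. (x, y) \<in> A} = (\<lambda>x. (x, y)) -` A" for y and A :: "('a \<times> 'b) set" by auto
    have UL: "U - L \<in> sets ?R" using * by auto
    \<comment> \<open>The section measures of \<open>U - L\<close> are nonnegative and integrate to
      the measure of \<open>U - L\<close>, which is 0.\<close>
    have "AE y in Q. emeasure ?P ((\<lambda>x. (x, y)) -` (U - L)) = 0"
      using R.emeasure_pair_measure_alt2[OF UL] *(5) R.measurable_emeasure_Pair2[OF UL]
      by (subst nn_integral_0_iff_AE[symmetric]) auto
    then have AE: "AE y in Q. emeasure ?P ((\<lambda>x. (x, y)) -` L) = ?h y"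
    proof (eventually_elim)
      fix y assume y: "emeasure ?P ((\<lambda>x. (x, y)) -` (U - L)) = 0"
      have m: "(\<lambda>x. (x, y)) -` A \<in> sets M1" if "A \<in> sets ?R" for A
        using sets_Pair2[OF that, of y] P by (simp add: sets_restr_to_subalg)
      have eP: "emeasure ?P ((\<lambda>x. (x, y)) -` A) = emeasure P ((\<lambda>x. (x, y)) -` A)"
        if "A \<in> sets ?R" for A
        by (rule emeasure_restr_to_subalg[OF P(2) m[OF that]])
      have mP: "(\<lambda>x. (x, y)) -` A \<in> sets P" if "A \<in> sets ?R" for A
        using m[OF that] P(2) by (auto simp: subalgebra_def)
      have null: "(\<lambda>x. (x, y)) -` (U - L) \<in> null_sets P"
        using y mP[OF UL] unfolding eP[OF UL] by auto
      have "?h y \<le> emeasure P ((\<lambda>x. (x, y)) -` L \<union> (\<lambda>x. (x, y)) -` (U - L))"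
        using *(4) mP[OF *(1)] mP[OF UL] by (intro emeasure_mono) auto
      also have "\<dots> = emeasure P ((\<lambda>x. (x, y)) -` L)"
        by (rule emeasure_Un_null_set[OF mP[OF *(1)] null])
      finally have "?h y \<le> emeasure P ((\<lambda>x. (x, y)) -` L)" .
      moreover have "emeasure P ((\<lambda>x. (x, y)) -` L) \<le> ?h y"
        using *(3) D1[of y] by (intro emeasure_mono) auto
      ultimately show "emeasure ?P ((\<lambda>x. (x, y)) -` L) = ?h y"
        unfolding eP[OF *(1)] by (rule antisym[rotated])
    qed
    let ?g = "\<lambda>y. emeasure ?P ((\<lambda>x. (x, y)) -` L)"
    have g: "?g \<in> borel_measurable (completion Q)"
      using R.measurable_emeasure_Pair2[OF *(1)] by (rule measurable_completion)
    show ?thesis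
    proof (rule measurableI)
      fix S :: "ennreal set" assume "S \<in> sets borel"
      then have S: "?g -` S \<inter> space (completion Q) \<in> sets (completion Q)"
        by (rule measurable_sets[OF g])
      show "?h -` S \<inter> space (completion Q) \<in> sets (completion Q)"
        by (rule completion.in_sets_AE[OF _ S]) (use AE in \<open>auto simp: AE_completion_iff\<close>)
    qed simp
  qed
  show ?thesis
  proof (rule measurableI)
    fix S :: "ennreal set" assume S: "S \<in> sets borel"
    show "?h -` S \<inter> space (universal_completion M2) \<in> sets (universal_completion M2)"
      unfolding sets_universal_completion[OF M2]
    proof (intro allI impI)
      fix Q assume Q: "prob_space Q" "sets Q = sets M2"
      show "?h -` S \<inter> space (universal_completion M2) \<in> sets (completion Q)"
        using measurable_sets[OF h[OF Q] S] sets_eq_imp_space_eq[OF Q(2)] by simp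
    qed
  qed simp
qed

section \<open>Spaces isomorphic to their square\<close>

text \<open>A sandwich from \<open>A\<close> is also one from \<open>B\<close>, because both
  restrictions agree with \<open>Q\<close> on \<open>A\<close>. This moves between the bases
  \<open>M \<Otimes>\<^sub>M M\<close>, \<open>\<Omega> \<Otimes>\<^sub>M \<Omega>\<close> and the
  full domain of \<open>Q\<close>.\<close>

lemma sets_completion_restr_mono:
  assumes "subalgebra Q B" "subalgebra B A"
  shows "sets (completion (restr_to_subalg Q A)) \<subseteq> sets (completion (restr_to_subalg Q B))"
proof -
  have A: "subalgebra Q A" using assms by (auto simp: subalgebra_def)
  have e: "emeasure (restr_to_subalg Q B) C = emeasure (restr_to_subalg Q A) C" if "C \<in> sets A" for C
    using that assms A by (auto simp: emeasure_restr_to_subalg subalgebra_def)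
  have s: "sets (restr_to_subalg Q A) = sets A" "sets (restr_to_subalg Q B) = sets B" "sets A \<subseteq> sets B"
    using assms A by (auto simp: sets_restr_to_subalg subalgebra_def)
  show ?thesis
  proof
    fix D assume "D \<in> sets (completion (restr_to_subalg Q A))"
    then obtain L U where *: "L \<in> sets A" "U \<in> sets A" "L \<subseteq> D" "D \<subseteq> U"
        "emeasure (restr_to_subalg Q A) (U - L) = 0"
      unfolding sets_completion_iff_sandwich s by blast
    then have "emeasure (restr_to_subalg Q B) (U - L) = 0"
      using e[of "U - L"] by simp
    then show "D \<in> sets (completion (restr_to_subalg Q B))"
      unfolding sets_completion_iff_sandwich s using * s(3) by blast
  qed
qed

lemma sets_completion_restr_subset:
  "subalgebra Q B \<Longrightarrow> sets (completion (restr_to_subalg Q B)) \<subseteq> sets (completion Q)"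
  using sets_completion_restr_mono[of Q Q B] restr_to_subalg_cong_sets[of Q Q]
  by (simp add: subalgebra_def)

text \<open>Recasts an inclusion of \<sigma>-algebras as measurability of the identity, so that the
  measurability rules for pairs can prove it.\<close>

lemma subalgebra_of_measurable_id:
  assumes f: "(\<lambda>x. x) \<in> M \<rightarrow>\<^sub>M N" and "space N = space M"
  shows "subalgebra M N"
  unfolding subalgebra_def
proof (intro conjI subsetI)
  fix A assume A: "A \<in> sets N"
  have "(\<lambda>x. x) -` A \<inter> space M = A"
    using sets.sets_into_space[OF A] assms(2) by auto
  then show "A \<in> sets M"
    using measurable_sets[OF f A] by simp
qed (rule assms(2))

lemma restrict_in_meas_maps:
  assumes "f \<in> A \<rightarrow>\<^sub>M B" shows "restrict f (space A) \<in> meas_maps A B"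
proof -
  have "restrict f (space A) \<in> A \<rightarrow>\<^sub>M B"
    by (rule measurable_cong[THEN iffD2, OF _ assms]) simp
  then show ?thesis by (simp add: meas_maps_def)
qed

text \<open>A Borel isomorphism of a nonempty space with its square, given by two mutually inverse
  measurable maps. Only countable separation and perfectness look further into the cube.\<close>

locale self_square =
  fixes M :: "'a measure" and \<theta> :: "'a \<Rightarrow> 'a \<times> 'a" and \<xi> :: "'a \<times> 'a \<Rightarrow> 'a"
  assumes nonempty: "space M \<noteq> {}"
    and \<theta>_meas: "\<theta> \<in> M \<rightarrow>\<^sub>M M \<Otimes>\<^sub>M M"
    and \<xi>_meas: "\<xi> \<in> M \<Otimes>\<^sub>M M \<rightarrow>\<^sub>M M"
    and \<xi>_\<theta>: "\<And>x. x \<in> space M \<Longrightarrow> \<xi> (\<theta> x) = x"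
    and \<theta>_\<xi>: "\<And>p. p \<in> space (M \<Otimes>\<^sub>M M) \<Longrightarrow> \<theta> (\<xi> p) = p"
begin

abbreviation "\<Omega> \<equiv> universal_completion M"
abbreviation "F \<equiv> meas_maps \<Omega> \<Omega>"
abbreviation "Ps \<equiv> all_probs \<Omega>"

section \<open>Measurable maps into the square and sections\<close>

lemma nonempty_square: "space (M \<Otimes>\<^sub>M M) \<noteq> {}"
  using nonempty by (simp add: space_pair_measure)

lemma measurable_to_base: "f \<in> N \<rightarrow>\<^sub>M \<Omega> \<Longrightarrow> f \<in> N \<rightarrow>\<^sub>M M"
  using measurable_mono[of M \<Omega> N N] sets_subset_universal_completion[OF nonempty] by auto

lemma measurable_from_base: "f \<in> M \<rightarrow>\<^sub>M N \<Longrightarrow> f \<in> \<Omega> \<rightarrow>\<^sub>M universal_completion N"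
  by (rule measurable_universal_completion_mono[OF _ nonempty])

lemma meas_maps_base: "meas_maps \<Omega> M = F"
  using measurable_universal_completion[OF _ nonempty, of _ M] measurable_to_base[of _ \<Omega>]
  by (auto simp: meas_maps_def)

lemma pair_map_measurable:
  assumes "f \<in> F" "g \<in> F"
  shows "pair_map (space M) f g \<in> \<Omega> \<rightarrow>\<^sub>M universal_completion (M \<Otimes>\<^sub>M M)"
proof (rule measurable_universal_completion[OF _ nonempty])
  have "(\<lambda>x. (f x, g x)) \<in> \<Omega> \<rightarrow>\<^sub>M M \<Otimes>\<^sub>M M"
    using assms by (intro measurable_Pair measurable_to_base) (auto simp: meas_maps_def)
  from restrict_in_meas_maps[OF this]
  show "pair_map (space M) f g \<in> \<Omega> \<rightarrow>\<^sub>M M \<Otimes>\<^sub>M M"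
    by (simp add: pair_map_def meas_maps_def)
qed

text \<open>Together with \<open>\<phi>2\<close> this is the pair in \<open>F\<close> that
  represents \<open>\<theta>\<close>. It serves both as the decisive test for
  \<open>square_sets\<close> and as the pair of maps realising product measures.\<close>

definition "\<phi>1 = (\<lambda>x\<in>space M. fst (\<theta> x))"
definition "\<phi>2 = (\<lambda>x\<in>space M. snd (\<theta> x))"

lemma \<phi>_in: "\<phi>1 \<in> F" "\<phi>2 \<in> F"
proof -
  have "(\<lambda>x. fst (\<theta> x)) \<in> \<Omega> \<rightarrow>\<^sub>M \<Omega>"
    by (rule measurable_from_base[OF measurable_compose[OF \<theta>_meas measurable_fst]])
  from restrict_in_meas_maps[OF this] show "\<phi>1 \<in> F"
    by (simp add: \<phi>1_def)
  have "(\<lambda>x. snd (\<theta> x)) \<in> \<Omega> \<rightarrow>\<^sub>M \<Omega>"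
    by (rule measurable_from_base[OF measurable_compose[OF \<theta>_meas measurable_snd]])
  from restrict_in_meas_maps[OF this] show "\<phi>2 \<in> F"
    by (simp add: \<phi>2_def)
qed

lemma pair_map_\<phi>: "pair_map (space M) \<phi>1 \<phi>2 = restrict \<theta> (space M)"
  by (auto simp: pair_map_def \<phi>1_def \<phi>2_def)

text \<open>One test pair suffices for the inclusion from left to right:
  \<open>(\<phi>1, \<phi>2)\<close> pulls \<open>D\<close> back along \<open>\<theta>\<close>, and
  pulling the result back along \<open>\<xi>\<close>, which is measurable between the completions,
  returns \<open>D\<close>.\<close>

lemma square_sets_eq: "square_sets \<Omega> F = sets (universal_completion (M \<Otimes>\<^sub>M M))"
proof (intro subset_antisym subsetI)
  fix D assume D: "D \<in> square_sets \<Omega> F"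
  have "pair_map (space M) \<phi>1 \<phi>2 -` D \<inter> space M \<in> sets \<Omega>"
    using D \<phi>_in by (auto simp: square_sets_def)
  then have "\<theta> -` D \<inter> space M \<in> sets \<Omega>"
    unfolding pair_map_\<phi> by (simp cong: rev_conj_cong add: vimage_def Int_def)
  from measurable_sets[OF measurable_universal_completion_mono[OF \<xi>_meas nonempty_square] this]
  have "\<xi> -` (\<theta> -` D \<inter> space M) \<inter> space (M \<Otimes>\<^sub>M M) \<in> sets (universal_completion (M \<Otimes>\<^sub>M M))"
    by simp
  also have "\<xi> -` (\<theta> -` D \<inter> space M) \<inter> space (M \<Otimes>\<^sub>M M) = D"
    using D measurable_space[OF \<xi>_meas] \<theta>_\<xi> by (auto simp: square_sets_def space_pair_measure)
  finally show "D \<in> sets (universal_completion (M \<Otimes>\<^sub>M M))" .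
next
  fix D assume D: "D \<in> sets (universal_completion (M \<Otimes>\<^sub>M M))"
  then show "D \<in> square_sets \<Omega> F"
    using sets.sets_into_space[OF D] measurable_sets[OF pair_map_measurable D]
    by (auto simp: square_sets_def space_pair_measure)
qed

text \<open>For \<open>y\<close> in the space, the embeddings of \<open>M\<close> as a line in the
  square are measurable on the base, hence between the completions. Points outside the space, with
  empty sections, are included because the section lemmas quantify over all
  \<open>y\<close>.\<close>

lemma section_in_sets:
  assumes "D \<in> sets (universal_completion (M \<Otimes>\<^sub>M M))"
  shows "{x. (x, y) \<in> D} \<in> sets \<Omega>" and "{x. (y, x) \<in> D} \<in> sets \<Omega>"
proof -
  have sp: "D \<subseteq> space M \<times> space M"
    using sets.sets_into_space[OF assms] by (simp add: space_pair_measure)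
  have "{x. (x, y) \<in> D} \<in> sets \<Omega> \<and> {x. (y, x) \<in> D} \<in> sets \<Omega>"
  proof (cases "y \<in> space M")
    case True
    have "(\<lambda>x. (x, y)) -` D \<inter> space \<Omega> \<in> sets \<Omega>" "(\<lambda>x. (y, x)) -` D \<inter> space \<Omega> \<in> sets \<Omega>"
      using measurable_sets[OF measurable_from_base[OF measurable_Pair2'[OF True]] assms]
        measurable_sets[OF measurable_from_base[OF measurable_Pair1'[OF True]] assms]
      by simp_all
    moreover have "(\<lambda>x. (x, y)) -` D \<inter> space \<Omega> = {x. (x, y) \<in> D}"
        "(\<lambda>x. (y, x)) -` D \<inter> space \<Omega> = {x. (y, x) \<in> D}"
      using sp by auto
    ultimately show ?thesis by simp
  next
    case False
    then have "{x. (x, y) \<in> D} = {}" "{x. (y, x) \<in> D} = {}" using sp by auto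
    then show ?thesis by simp
  qed
  then show "{x. (x, y) \<in> D} \<in> sets \<Omega>" and "{x. (y, x) \<in> D} \<in> sets \<Omega>" by auto
qed

section \<open>Iterated integrals, product measures and the sample space\<close>

lemma probsD:
  assumes "P \<in> Ps"
  shows "prob_space P" "sets P = sets \<Omega>" "space P = space M" "subalgebra P M"
  using assms subalgebra_universal_completion[OF nonempty assms] sets_eq_imp_space_eq[of P \<Omega>]
  by (auto simp: all_probs_def)

text \<open>Both orders of integration are evaluated by the same completed product measure, so the
  Fubini property is immediate.\<close>

lemma section_integrals:
  assumes "P1 \<in> Ps" "P2 \<in> Ps" "D \<in> sets (universal_completion (M \<Otimes>\<^sub>M M))"
  defines "R \<equiv> restr_to_subalg P1 M \<Otimes>\<^sub>M restr_to_subalg P2 M"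
  shows "(\<integral>\<^sup>+ y. emeasure P1 {x. (x, y) \<in> D} \<partial>P2) = emeasure (completion R) D"
    and "(\<integral>\<^sup>+ x. emeasure P2 {y. (x, y) \<in> D} \<partial>P1) = emeasure (completion R) D"
  unfolding R_def
  by (rule nn_integral_sections_universal_completion[OF probsD(1,4)[OF assms(1)] probsD(1,4)[OF assms(2)] assms(3)];
      simp only: probsD(2)[OF assms(1)] probsD(2)[OF assms(2)] section_in_sets[OF assms(3)])+

lemma fubini: "fubini \<Omega> F Ps"
  unfolding fubini_def square_sets_eq by (intro ballI) (simp only: section_integrals)

text \<open>The completed product measure lives on the square; \<open>\<xi>\<close> carries it to a
  measure \<open>P\<close> on \<open>\<Omega>\<close>, and the pair
  \<open>(\<phi>1, \<phi>2)\<close>, which is \<open>\<theta>\<close>, undoes the transport.\<close>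

lemma products_exist:
  assumes P1: "P1 \<in> Ps" and P2: "P2 \<in> Ps"
  shows "\<exists>P\<in>Ps. \<exists>\<Phi>1\<in>F. \<exists>\<Phi>2\<in>F. \<forall>D\<in>square_sets \<Omega> F.
            (\<integral>\<^sup>+ \<omega>2. emeasure P1 {\<omega>1. (\<omega>1, \<omega>2) \<in> D} \<partial>P2)
              = emeasure P (pair_map (space \<Omega>) \<Phi>1 \<Phi>2 -` D \<inter> space \<Omega>)"
proof -
  define R where "R = restr_to_subalg P1 M \<Otimes>\<^sub>M restr_to_subalg P2 M"
  have sR: "sets R = sets (M \<Otimes>\<^sub>M M)"
    unfolding R_def using probsD[OF P1] probsD[OF P2]
    by (intro sets_pair_measure_cong sets_restr_to_subalg)
  have spR: "space R = space (M \<Otimes>\<^sub>M M)"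
    by (rule sets_eq_imp_space_eq[OF sR])
  have R: "prob_space R"
    unfolding R_def using probsD[OF P1] probsD[OF P2]
    by (intro prob_space_pair prob_space_restr_to_subalg)
  have sub: "sets (universal_completion (M \<Otimes>\<^sub>M M)) \<subseteq> sets (completion R)"
    by (rule sets_universal_completion_subset_completion[OF R sR])
  \<comment> \<open>Completing \<open>R\<close> is what makes the preimages of all universally
    measurable sets, and not just of Borel sets, measurable.\<close>
  have \<xi>: "\<xi> \<in> completion R \<rightarrow>\<^sub>M \<Omega>"
    using measurable_universal_completion_mono[OF \<xi>_meas nonempty_square]
      measurable_mono[of \<Omega> \<Omega> "universal_completion (M \<Otimes>\<^sub>M M)" "completion R"] sub spR by auto
  define P where "P = distr (completion R) \<Omega> \<xi>"
  have "P \<in> Ps"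
    using prob_space.prob_space_distr[OF prob_space.prob_space_completion[OF R] \<xi>]
    by (simp add: P_def all_probs_def)
  moreover have "(\<integral>\<^sup>+ \<omega>2. emeasure P1 {\<omega>1. (\<omega>1, \<omega>2) \<in> D} \<partial>P2)
              = emeasure P (pair_map (space \<Omega>) \<phi>1 \<phi>2 -` D \<inter> space \<Omega>)"
    if D: "D \<in> square_sets \<Omega> F" for D
  proof -
    have D': "D \<in> sets (universal_completion (M \<Otimes>\<^sub>M M))"
      using D by (simp add: square_sets_eq)
    have D'': "D \<subseteq> space R"
      using sets.sets_into_space[OF D'] spR by simp
    have "pair_map (space \<Omega>) \<phi>1 \<phi>2 -` D \<inter> space \<Omega> \<in> sets \<Omega>"
      using D \<phi>_in by (auto simp: square_sets_def)
    then have "emeasure P (pair_map (space \<Omega>) \<phi>1 \<phi>2 -` D \<inter> space \<Omega>)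
        = emeasure (completion R) (\<xi> -` (pair_map (space \<Omega>) \<phi>1 \<phi>2 -` D \<inter> space \<Omega>) \<inter> space R)"
      unfolding P_def by (subst emeasure_distr[OF \<xi>]) (auto simp del: emeasure_completion)
    also have "\<xi> -` (pair_map (space \<Omega>) \<phi>1 \<phi>2 -` D \<inter> space \<Omega>) \<inter> space R = D"
      using D'' \<theta>_\<xi> measurable_space[OF \<xi>_meas] by (auto simp: pair_map_\<phi> spR)
    finally show ?thesis
      using section_integrals(1)[OF P1 P2 D'] by (simp add: R_def del: emeasure_completion)
  qed
  ultimately show ?thesis using \<phi>_in by blast
qed

lemma sample_space: "sample_space \<Omega> F Ps"
proof
  show "space \<Omega> \<noteq> {}" using nonempty by simp
  show "F \<subseteq> space \<Omega> \<rightarrow>\<^sub>E space \<Omega>"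
    by (auto simp: meas_maps_def PiE_def dest: measurable_space)
  show "(\<lambda>\<omega>\<in>space \<Omega>. \<omega>) \<in> F"
    by (intro restrict_in_meas_maps) simp
  show "(\<lambda>\<omega>\<in>space \<Omega>. c) \<in> F" if "c \<in> space \<Omega>" for c
    using that by (intro restrict_in_meas_maps) simp
  show "compose (space \<Omega>) \<Phi> \<Psi> \<in> F" if "\<Phi> \<in> F" "\<Psi> \<in> F" for \<Phi> \<Psi>
    using restrict_in_meas_maps[OF measurable_compose[of \<Psi> \<Omega> \<Omega> \<Phi> \<Omega>]] that
    by (simp add: compose_def meas_maps_def)
  show "\<Phi> \<in> \<Omega> \<rightarrow>\<^sub>M \<Omega>" if "\<Phi> \<in> F" for \<Phi>
    using that by (simp add: meas_maps_def)
  show "Ps \<noteq> {}" using nonempty by (intro all_probs_nonempty) simp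
  show "prob_space P \<and> space P = space \<Omega>" if "P \<in> Ps" for P
    using probsD[OF that] by simp
  show "\<Phi> -` D \<inter> space \<Omega> \<in> sets P" if "\<Phi> \<in> F" "P \<in> Ps" "D \<in> sets \<Omega>" for \<Phi> P D
    using that probsD[OF that(2)] measurable_sets[of \<Phi> \<Omega> \<Omega> D] by (auto simp: meas_maps_def)
  show "(\<lambda>\<omega>. emeasure P {\<omega>1. (\<omega>1, \<omega>) \<in> D}) \<in> borel_measurable \<Omega>"
    if "D \<in> square_sets \<Omega> F" "P \<in> Ps" for D P
    using that(1) section_in_sets(1) unfolding square_sets_eq
    by (intro measurable_emeasure_section_universal_completion[OF probsD(1,4)[OF that(2)] nonempty])
      (simp_all only: probsD(2)[OF that(2)])
qed (rule products_exist)

lemma square_iso: "square_iso (space \<Omega>) F \<theta>"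
  unfolding square_iso_def
proof (intro conjI subset_antisym subsetI)
  show "bij_betw \<theta> (space \<Omega>) (space \<Omega> \<times> space \<Omega>)"
    using measurable_space[OF \<theta>_meas] measurable_space[OF \<xi>_meas] \<theta>_\<xi> \<xi>_\<theta>
    by (intro bij_betwI[where g = \<xi>]) (auto simp: space_pair_measure)
next
  fix h assume "h \<in> {compose (space \<Omega>) \<theta> \<Phi> |\<Phi>. \<Phi> \<in> F}"
  then obtain \<Phi> where \<Phi>: "\<Phi> \<in> F" and h: "h = compose (space \<Omega>) \<theta> \<Phi>" by auto
  let ?f1 = "compose (space \<Omega>) \<phi>1 \<Phi>" and ?f2 = "compose (space \<Omega>) \<phi>2 \<Phi>"
  have "?f1 \<in> F" "?f2 \<in> F"
    using sample_space.maps_comp[OF sample_space] \<phi>_in \<Phi> by auto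
  moreover have "h = pair_map (space \<Omega>) ?f1 ?f2"
  proof
    fix x
    show "h x = pair_map (space \<Omega>) ?f1 ?f2 x"
    proof (cases "x \<in> space M")
      case True
      then have "\<Phi> x \<in> space M"
        using \<Phi> measurable_space[of \<Phi> \<Omega> \<Omega> x] by (simp add: meas_maps_def)
      with True show ?thesis
        by (simp add: h compose_def pair_map_def \<phi>1_def \<phi>2_def)
    qed (simp add: h compose_def pair_map_def)
  qed
  ultimately show "h \<in> {pair_map (space \<Omega>) \<Phi>1 \<Phi>2 |\<Phi>1 \<Phi>2. \<Phi>1 \<in> F \<and> \<Phi>2 \<in> F}" by blast
next
  fix h assume "h \<in> {pair_map (space \<Omega>) \<Phi>1 \<Phi>2 |\<Phi>1 \<Phi>2. \<Phi>1 \<in> F \<and> \<Phi>2 \<in> F}"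
  then obtain f g where fg: "f \<in> F" "g \<in> F" and h: "h = pair_map (space \<Omega>) f g" by auto
  have hm: "h \<in> \<Omega> \<rightarrow>\<^sub>M universal_completion (M \<Otimes>\<^sub>M M)"
    using pair_map_measurable[OF fg] by (simp add: h)
  \<comment> \<open>Composing with the inverse \<open>\<xi>\<close> stays in \<open>F\<close>, since
    \<open>h\<close> is measurable into the completed square and \<open>\<xi>\<close> between the
    completions.\<close>
  let ?\<Phi> = "\<lambda>x\<in>space \<Omega>. \<xi> (h x)"
  have "?\<Phi> \<in> F"
    using measurable_compose[OF hm measurable_universal_completion_mono[OF \<xi>_meas nonempty_square]]
    by (rule restrict_in_meas_maps)
  moreover have "h = compose (space \<Omega>) \<theta> ?\<Phi>"
  proof
    fix x
    show "h x = compose (space \<Omega>) \<theta> ?\<Phi> x"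
      using measurable_space[OF hm, of x] \<theta>_\<xi>[of "h x"]
      by (cases "x \<in> space M") (auto simp: compose_def h pair_map_def)
  qed
  ultimately show "h \<in> {compose (space \<Omega>) \<theta> \<Phi> |\<Phi>. \<Phi> \<in> F}" by blast
qed

text \<open>Pushing forward along the identity puts all of \<open>Ps\<close> among the test
  measures, so \<open>universal_completion_closed\<close> applies.\<close>

lemma Q_complete_push_probs: "Q_complete \<Omega> (push_probs \<Omega> F Ps)"
proof -
  have sub: "subalgebra Q \<Omega>" "sets Q = sets \<Omega>" if "Q \<in> push_probs \<Omega> F Ps" for Q
    using that by (auto simp: push_probs_def subalgebra_def)
  have Ps: "P \<in> push_probs \<Omega> F Ps" if P: "P \<in> Ps" for P
  proof -
    have "distr P \<Omega> (\<lambda>x\<in>space \<Omega>. x) = distr P P (\<lambda>x. x)"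
      using probsD[OF P] by (intro distr_cong) auto
    then have "P = distr P \<Omega> (\<lambda>x\<in>space \<Omega>. x)" by simp
    then show ?thesis
      unfolding push_probs_def using P sample_space.maps_id[OF sample_space] by blast
  qed
  have ne: "push_probs \<Omega> F Ps \<noteq> {}"
    using Ps sample_space.probs_nonempty[OF sample_space] by blast
  have "sets (Q_completion \<Omega> (push_probs \<Omega> F Ps)) = (\<Inter>Q\<in>push_probs \<Omega> F Ps. sets (completion Q))"
    by (subst sets_Q_completion[OF ne]) (auto simp: sub restr_to_subalg_cong_sets)
  also have "\<dots> = sets \<Omega>"
    using sub(2) Ps by (auto intro!: universal_completion_closed[OF nonempty])
  finally show ?thesis by (simp add: Q_complete_def)
qed

text \<open>\<open>\<Omega> \<Otimes>\<^sub>M \<Omega>\<close> lies between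
  \<open>M \<Otimes>\<^sub>M M\<close> and its universal completion. A universally measurable set is
  thus measurable for every \<open>Q\<close> completed from the middle \<sigma>-algebra. Conversely,
  completeness for the image of \<open>P\<close> under a pair of maps is just what pulls back to the
  completion of \<open>P\<close>.\<close>

lemma square_sets_Q_completion:
  "square_sets \<Omega> F = sets (Q_completion (\<Omega> \<Otimes>\<^sub>M \<Omega>) (push_probs_square \<Omega> F Ps))"
proof -
  let ?U = "universal_completion (M \<Otimes>\<^sub>M M)" and ?Q = "push_probs_square \<Omega> F Ps"
  have sq: "sets (square_space \<Omega> F) = sets ?U"
    using sample_space.maps_ext[OF sample_space]
    by (subst sets_square_space) (auto simp: square_sets_eq PiE_def)
  have spsq: "space (square_space \<Omega> F) = space M \<times> space M"
    using sets_eq_imp_space_eq[OF sq] by (simp add: space_pair_measure)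
  \<comment> \<open>This is the identity, written as a pair so that each component can be treated
    separately.\<close>
  have "(\<lambda>p. (fst p, snd p)) \<in> ?U \<rightarrow>\<^sub>M \<Omega> \<Otimes>\<^sub>M \<Omega>"
    by (intro measurable_Pair measurable_universal_completion_mono nonempty_square) auto
  then have le: "subalgebra ?U (\<Omega> \<Otimes>\<^sub>M \<Omega>)"
    by (intro subalgebra_of_measurable_id) (simp_all add: space_pair_measure)
  have "(\<lambda>p. (fst p, snd p)) \<in> \<Omega> \<Otimes>\<^sub>M \<Omega> \<rightarrow>\<^sub>M M \<Otimes>\<^sub>M M"
    by (intro measurable_Pair measurable_to_base) auto
  then have ge: "subalgebra (\<Omega> \<Otimes>\<^sub>M \<Omega>) (M \<Otimes>\<^sub>M M)"
    by (intro subalgebra_of_measurable_id) (simp_all add: space_pair_measure)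
  have pm: "pair_map (space \<Omega>) f g \<in> P \<rightarrow>\<^sub>M square_space \<Omega> F" if "P \<in> Ps" "f \<in> F" "g \<in> F" for P f g
    using pair_map_measurable[OF that(2,3)] measurable_cong_sets[OF probsD(2)[OF that(1)] sq] by simp
  have sub: "subalgebra Q (\<Omega> \<Otimes>\<^sub>M \<Omega>)" if "Q \<in> ?Q" for Q
  proof -
    have "sets Q = sets ?U" using that by (auto simp: push_probs_square_def sq)
    then show ?thesis using le sets_eq_imp_space_eq[of Q ?U] by (simp add: subalgebra_def)
  qed
  have prob: "prob_space Q" if "Q \<in> ?Q" for Q
    using that pm prob_space.prob_space_distr[OF probsD(1)] unfolding push_probs_square_def by blast
  have ne: "?Q \<noteq> {}"
    using sample_space.probs_nonempty[OF sample_space] \<phi>_in by (auto simp: push_probs_square_def)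
  have Q: "sets (Q_completion (\<Omega> \<Otimes>\<^sub>M \<Omega>) ?Q)
      = (\<Inter>Q\<in>?Q. sets (completion (restr_to_subalg Q (\<Omega> \<Otimes>\<^sub>M \<Omega>))))"
    by (rule sets_Q_completion[OF ne sub])
  show ?thesis
  proof (intro subset_antisym subsetI)
    fix D assume "D \<in> square_sets \<Omega> F"
    then have D: "D \<in> sets ?U" by (simp add: square_sets_eq)
    have "D \<in> sets (completion (restr_to_subalg Q (\<Omega> \<Otimes>\<^sub>M \<Omega>)))" if "Q \<in> ?Q" for Q
    proof -
      have "subalgebra Q (M \<Otimes>\<^sub>M M)"
        using ge sub[OF that] by (auto simp: subalgebra_def)
      then show ?thesis
        using universal_completion_in_completion_restr[OF prob[OF that] _ D]
          sets_completion_restr_mono[OF sub[OF that] ge] by auto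
    qed
    then show "D \<in> sets (Q_completion (\<Omega> \<Otimes>\<^sub>M \<Omega>) ?Q)" by (simp add: Q)
  next
    fix D assume D: "D \<in> sets (Q_completion (\<Omega> \<Otimes>\<^sub>M \<Omega>) ?Q)"
    have "pair_map (space \<Omega>) f g -` D \<inter> space \<Omega> \<in> sets \<Omega>" if fg: "f \<in> F" "g \<in> F" for f g
    proof (rule universal_completion_closed[OF nonempty])
      fix P assume P: "P \<in> Ps"
      let ?D = "distr P (square_space \<Omega> F) (pair_map (space \<Omega>) f g)"
      have "?D \<in> ?Q" using P fg by (auto simp: push_probs_square_def)
      then have "D \<in> sets (completion ?D)"
        using D sets_completion_restr_subset[OF sub] unfolding Q by blast
      from vimage_in_completion[OF pm[OF P fg] this]
      show "pair_map (space \<Omega>) f g -` D \<inter> space \<Omega> \<in> sets (completion P)"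
        using probsD(3)[OF P] by simp
    qed
    then show "D \<in> square_sets \<Omega> F"
      using sets.sets_into_space[OF D] by (auto simp: square_sets_def space_pair_measure)
  qed
qed

end

section \<open>The Hilbert cube\<close>

lemma space_cube_borel: "space cube_borel = UNIV \<rightarrow> {0..1}"
  by (simp add: cube_borel_def space_PiM space_restrict_space PiE_UNIV_domain)

lemma space_cube_borel_nonempty: "space cube_borel \<noteq> {}"
  by (auto simp: space_cube_borel)

lemma cube_borel_coordinate_interval: "(\<lambda>x. x n) \<in> cube_borel \<rightarrow>\<^sub>M restrict_space borel {0..1}"
  unfolding cube_borel_def by (rule measurable_component_singleton) simp

lemma cube_borel_coordinate: "(\<lambda>x. x n) \<in> borel_measurable cube_borel"
  using cube_borel_coordinate_interval[of n] by (simp add: measurable_restrict_space2_iff)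

lemma measurable_into_cube_borel:
  assumes "\<And>n. (\<lambda>x. f x n) \<in> M \<rightarrow>\<^sub>M restrict_space borel {0..1}"
  shows "f \<in> M \<rightarrow>\<^sub>M cube_borel"
  unfolding cube_borel_def
proof (rule measurable_PiM_single')
  show "f \<in> space M \<rightarrow> (\<Pi>\<^sub>E n\<in>UNIV. space (restrict_space borel {0..1}))"
    using measurable_space[OF assms] by (auto simp: PiE_UNIV_domain)
qed (rule assms)

text \<open>Passes from coordinates to the Borel sets of the product topology on real sequences, the
  setting in which inner regularity by compact sets is applied.\<close>

lemma measurable_into_borel_sequences:
  fixes f :: "'a \<Rightarrow> nat \<Rightarrow> real"
  assumes "\<And>n. (\<lambda>x. f x n) \<in> borel_measurable M"
  shows "f \<in> borel_measurable M"
proof -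
  have "f \<in> M \<rightarrow>\<^sub>M (\<Pi>\<^sub>M n\<in>UNIV. borel)"
    by (rule measurable_PiM_single') (use assms in \<open>auto simp: PiE_UNIV_domain\<close>)
  then show ?thesis
    by (simp add: measurable_cong_sets[OF refl sets_PiM_equal_borel])
qed

lemma self_square_cube_borel:
  "self_square cube_borel (\<lambda>x. (\<lambda>n. x (2 * n), \<lambda>n. x (2 * n + 1)))
     (\<lambda>(a, b) n. if even n then a (n div 2) else b (n div 2))"
proof
  show "space cube_borel \<noteq> {}" by (rule space_cube_borel_nonempty)
  show "(\<lambda>x. (\<lambda>n. x (2 * n), \<lambda>n. x (2 * n + 1))) \<in> cube_borel \<rightarrow>\<^sub>M cube_borel \<Otimes>\<^sub>M cube_borel"
    by (intro measurable_Pair measurable_into_cube_borel cube_borel_coordinate_interval)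
  show "(\<lambda>(a, b) n. if even n then a (n div 2) else b (n div 2)) \<in> cube_borel \<Otimes>\<^sub>M cube_borel \<rightarrow>\<^sub>M cube_borel"
  proof (rule measurable_into_cube_borel)
    fix n
    show "(\<lambda>p. (case p of (a, b) \<Rightarrow> \<lambda>n. if even n then a (n div 2) else b (n div 2)) n)
        \<in> cube_borel \<Otimes>\<^sub>M cube_borel \<rightarrow>\<^sub>M restrict_space borel {0..1}"
      using measurable_compose[OF measurable_fst cube_borel_coordinate_interval, of "n div 2"]
        measurable_compose[OF measurable_snd cube_borel_coordinate_interval, of "n div 2"]
      by (cases "even n") (simp_all add: case_prod_beta')
  qed
qed (auto simp: fun_eq_iff)

interpretation cube: self_square cube_borel
  "\<lambda>x. (\<lambda>n. x (2 * n), \<lambda>n. x (2 * n + 1))"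
  "\<lambda>(a, b) n. if even n then a (n div 2) else b (n div 2)"
  by (rule self_square_cube_borel)

section \<open>Countable separation and perfectness\<close>

lemma countably_separated_cube: "countably_separated cube"
  unfolding countably_separated_def
proof (intro exI[of _ "range (\<lambda>(n, q::rat). {x \<in> space cube_borel. x n < of_rat q})"] conjI ballI impI)
  have "{x \<in> space cube_borel. x n < of_rat q} \<in> sets cube_borel" for n q
    using cube_borel_coordinate[of n] by measurable
  then show "range (\<lambda>(n, q::rat). {x \<in> space cube_borel. x n < of_rat q}) \<subseteq> sets cube"
    unfolding cube_def using sets_subset_universal_completion[OF space_cube_borel_nonempty] by auto
next
  fix x y :: "nat \<Rightarrow> real" assume xy: "x \<in> space cube" "y \<in> space cube" "x \<noteq> y"
  then obtain n where "x n \<noteq> y n" by auto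
  then have "min (x n) (y n) < max (x n) (y n)" by linarith
  then obtain q where "min (x n) (y n) < of_rat q" "of_rat q < max (x n) (y n)"
    using of_rat_dense by blast
  then have "x n < of_rat q \<longleftrightarrow> \<not> y n < of_rat q" by linarith
  then show "\<exists>C\<in>range (\<lambda>(n, q). {x \<in> space cube_borel. x n < of_rat q}). (x \<in> C) \<noteq> (y \<in> C)"
    using xy by (intro bexI[of _ "{x \<in> space cube_borel. x n < of_rat q}"]) (auto simp: cube_def)
qed simp

text \<open>A \<open>P\<close>-measurable \<open>f\<close> agrees off a null set with a Borel function \<open>g\<close>. The graph of \<open>g\<close>, coded
  as a set of sequences whose head is the function value, carries the image of \<open>P\<close>;
  inner regularity exhausts it by compact sets, whose projections to the head are compact subsets of
  the range of \<open>f\<close>. This replaces Lusin's theorem.\<close>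

lemma perfect_cube:
  assumes P: "P \<in> all_probs cube"
  shows "perfect P"
  unfolding perfect_def
proof
  fix f :: "(nat \<Rightarrow> real) \<Rightarrow> real" assume f: "f \<in> borel_measurable P"
  let ?B = "restr_to_subalg P cube_borel"
  note P' = cube.probsD[OF P[unfolded cube_def]]
  have sB: "sets ?B = sets cube_borel" by (rule sets_restr_to_subalg[OF P'(4)])
  have spB: "space ?B = space cube_borel" by (rule sets_eq_imp_space_eq[OF sB])
  interpret B: prob_space ?B by (rule prob_space_restr_to_subalg[OF P'(4,1)])
  have "sets P \<subseteq> sets (completion ?B)"
    using universal_completion_in_completion_restr[OF P'(1,4)] P'(2) by auto
  then have "f \<in> borel_measurable (completion ?B)"
    using f P'(3) spB unfolding measurable_def by auto
  then obtain g where g: "g \<in> borel_measurable ?B" and fg: "AE x in ?B. f x = g x"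
    using completion_ex_borel_measurable_real by blast
  have g': "g \<in> borel_measurable cube_borel"
    using g by (simp only: measurable_cong_sets[OF sB refl])
  obtain N where N: "{x \<in> space ?B. f x \<noteq> g x} \<subseteq> N" "N \<in> null_sets ?B"
    using fg by (auto elim: AE_E3 simp: eventually_ae_filter)
  \<comment> \<open>A Borel set of full measure on which \<open>f\<close> equals \<open>g\<close>;
    working inside it lets values of \<open>g\<close> count as values of \<open>f\<close>.\<close>
  define X where "X = space cube_borel - N"
  have X: "X \<in> sets cube_borel" and XB: "X \<in> sets ?B"
    using N(2) sB by (auto simp: X_def)
  have fgX: "f x = g x" if "x \<in> X" for x
    using that N(1) spB by (auto simp: X_def)
  have eX: "emeasure ?B X = 1"
  proof -
    have "emeasure ?B X = emeasure ?B (space ?B)"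
      unfolding X_def spB[symmetric] by (rule emeasure_Diff_null_set[OF N(2)]) simp
    then show ?thesis by (simp add: B.emeasure_space_1)
  qed
  \<comment> \<open>The graph embedding: \<open>g x\<close> is put in front of the sequence
    \<open>x\<close>, giving a point of the Polish space of all real sequences.\<close>
  define e where "e = (\<lambda>x n. case n of 0 \<Rightarrow> g x | Suc m \<Rightarrow> x m)"
  have e: "e \<in> borel_measurable ?B"
  proof (rule measurable_into_borel_sequences)
    fix n show "(\<lambda>x. e x n) \<in> borel_measurable ?B"
      using g' cube_borel_coordinate
      by (cases n) (simp_all add: e_def measurable_cong_sets[OF sB refl])
  qed
  \<comment> \<open>A Borel left inverse of \<open>e\<close> on the cube: it drops the head and
    forces the other entries into the unit interval, so that it is defined on all real
    sequences.\<close>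
  define clamp where "clamp = (\<lambda>z n. max 0 (min 1 (z (Suc n) :: real)))"
  have coord: "(\<lambda>z::nat \<Rightarrow> real. z n) \<in> borel_measurable borel" for n :: nat
    by (intro borel_measurable_continuous_onI continuous_on_product_coordinates)
  have clamp: "clamp \<in> borel \<rightarrow>\<^sub>M cube_borel"
  proof (rule measurable_into_cube_borel)
    fix n
    have "(\<lambda>z. clamp z n) \<in> borel_measurable borel"
      unfolding clamp_def by (intro borel_measurable_max borel_measurable_min borel_measurable_const coord)
    then show "(\<lambda>z. clamp z n) \<in> borel \<rightarrow>\<^sub>M restrict_space borel {0..1}"
      by (simp add: measurable_restrict_space2_iff clamp_def)
  qed
  \<comment> \<open>This is the image of \<open>X\<close> under \<open>e\<close>, described by
    equations with the left inverse so that it is visibly Borel, with no theorem on injective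
    images.\<close>
  define G where "G = {z. e (clamp z) = z \<and> clamp z \<in> X}"
  have clamp_e: "clamp (e x) = x" if "x \<in> space cube_borel" for x
    using that by (auto simp: clamp_def e_def space_cube_borel fun_eq_iff Pi_iff min_absorb2 max_absorb2)
  have G: "G \<in> sets borel"
  proof -
    have ec: "(\<lambda>z. e (clamp z) n) \<in> borel_measurable borel" for n
    proof -
      have "(\<lambda>x. e x n) \<in> borel_measurable cube_borel"
        using g' cube_borel_coordinate by (cases n) (simp_all add: e_def)
      then show ?thesis by (rule measurable_compose[OF clamp])
    qed
    have "{z. e (clamp z) n = z n} \<in> sets borel" for n
      using borel_measurable_eq[OF ec[of n] coord[of n]] by simp
    then have "(\<Inter>n. {z. e (clamp z) n = z n}) \<in> sets borel"
      by (intro sets.countable_INT'') auto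
    moreover have "clamp -` X \<in> sets borel"
      using measurable_sets[OF clamp X] by simp
    moreover have "G = (\<Inter>n. {z. e (clamp z) n = z n}) \<inter> clamp -` X"
      by (auto simp: G_def fun_eq_iff)
    ultimately show ?thesis by simp
  qed
  define \<mu> where "\<mu> = distr ?B borel e"
  have \<mu>: "emeasure \<mu> K = emeasure ?B (e -` K \<inter> space ?B)" if "K \<in> sets borel" for K
    unfolding \<mu>_def using that by (rule emeasure_distr[OF e])
  have XG: "e -` G \<inter> space ?B = X"
    using clamp_e sets.sets_into_space[OF X] by (auto simp: G_def spB)
  have eG: "emeasure \<mu> G = 1"
    unfolding \<mu>[OF G] XG by (rule eX)
  have s\<mu>: "sets \<mu> = sets borel" by (simp add: \<mu>_def)
  interpret \<mu>: prob_space \<mu>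
    unfolding \<mu>_def by (rule B.prob_space_distr[OF e])
  let ?K = "{K. K \<subseteq> G \<and> compact K}"
  have SUP: "1 = (SUP K\<in>?K. emeasure \<mu> K)"
    using inner_regular[OF s\<mu> _ G] eG by simp
  have "{} \<in> ?K" by simp
  then have "?K \<noteq> {}" by (rule ex_in_conv[THEN iffD1, OF exI])
  \<comment> \<open>A countable subfamily keeps the union of the projections Borel. Its members need
    not increase: each gives a lower bound, and the supremum of these bounds is 1.\<close>
  from ennreal_SUP_countable_SUP[OF this, of "emeasure \<mu>"]
  obtain h :: "nat \<Rightarrow> ennreal" where h: "range h \<subseteq> emeasure \<mu> ` ?K" "1 = Sup (range h)"
    unfolding SUP[symmetric] by blast
  from h(1) have "\<forall>n. \<exists>K. K \<subseteq> G \<and> compact K \<and> h n = emeasure \<mu> K" by blast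
  then obtain K where K: "\<And>n. K n \<subseteq> G" "\<And>n. compact (K n)" "\<And>n. h n = emeasure \<mu> (K n)"
    by metis
  \<comment> \<open>A countable union of compact sets of heads, hence Borel, although the range of
    \<open>f\<close> need not be.\<close>
  define S where "S = (\<Union>n. (\<lambda>z. z 0) ` K n)"
  have "compact ((\<lambda>z. z 0) ` K n)" for n
    by (rule compact_continuous_image[OF _ K(2)])
      (rule continuous_on_subset[OF continuous_on_product_coordinates subset_UNIV])
  then have S: "S \<in> sets borel"
    unfolding S_def by (intro sets.countable_UN) (auto intro: borel_compact)
  have "S \<subseteq> f ` space P"
  proof
    fix s assume "s \<in> S"
    then obtain n z where z: "z \<in> K n" "s = z 0" by (auto simp: S_def)
    then have "e (clamp z) = z" "clamp z \<in> X" using K(1) by (auto simp: G_def)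
    moreover from this(1) have "g (clamp z) = z 0" by (metis e_def nat.case(1))
    ultimately have "s = f (clamp z)" using fgX z by simp
    moreover have "clamp z \<in> space P"
      using \<open>clamp z \<in> X\<close> by (simp add: X_def P'(3))
    ultimately show "s \<in> f ` space P" by blast
  qed
  moreover have "emeasure P (f -` S \<inter> space P) = 1"
  proof (rule antisym)
    show "emeasure P (f -` S \<inter> space P) \<le> 1"
      by (rule prob_space.emeasure_le_1[OF P'(1)])
    have "h n \<le> emeasure P (f -` S \<inter> space P)" for n
    proof -
      have Kn: "K n \<in> sets borel" by (rule borel_compact[OF K(2)])
      have Kc: "e -` K n \<inter> space ?B \<in> sets cube_borel"
        using measurable_sets[OF e Kn] sB by simp
      have "h n = emeasure P (e -` K n \<inter> space ?B)"
        unfolding K(3) \<mu>[OF Kn] by (rule emeasure_restr_to_subalg[OF P'(4) Kc])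
      also have "\<dots> \<le> emeasure P (f -` S \<inter> space P)"
      proof (rule emeasure_mono)
        \<comment> \<open>Since \<open>K n\<close> lies in \<open>G\<close>, such an
          \<open>x\<close> belongs to \<open>X\<close>, where the head of \<open>e x\<close> is
          \<open>g x\<close>, that is, \<open>f x\<close>.\<close>
        show "e -` K n \<inter> space ?B \<subseteq> f -` S \<inter> space P"
        proof
          fix x assume x: "x \<in> e -` K n \<inter> space ?B"
          then have "x \<in> X" using K(1)[of n] XG by blast
          then have "f x = e x 0" by (simp add: fgX e_def)
          then show "x \<in> f -` S \<inter> space P"
            using x by (auto simp: S_def spB P'(3))
        qed
        show "f -` S \<inter> space P \<in> sets P" by (rule measurable_sets[OF f S])
      qed
      finally show ?thesis .
    qed
    then show "1 \<le> emeasure P (f -` S \<inter> space P)"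
      unfolding h(2) by (intro Sup_least) auto
  qed
  ultimately show "\<exists>S\<in>sets borel. S \<subseteq> f ` space P \<and> emeasure P (f -` S \<inter> space P) = 1"
    using S by blast
qed

theorem theorem7p2:
  shows "sample_space cube cube_maps cube_probs
    \<and> (fubini cube cube_maps cube_probs \<and> (\<exists>\<Theta>. square_iso (space cube) cube_maps \<Theta>))
    \<and> (countably_separated cube \<and> (\<forall>P\<in>cube_probs. perfect P)
        \<and> Q_complete cube (push_probs cube cube_maps cube_probs))
    \<and> (meas_maps cube cube_borel = meas_maps cube cube \<and> meas_maps cube cube = cube_maps
        \<and> square_sets cube cube_maps
            = sets (Q_completion (cube \<Otimes>\<^sub>M cube)
                (push_probs_square cube cube_maps cube_probs)))"
proof -
  have "countably_separated cube" "\<forall>P\<in>all_probs cube. perfect P"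
    using countably_separated_cube perfect_cube by auto
  then show ?thesis
    unfolding cube_maps_def cube_probs_def cube_def
    using cube.sample_space cube.fubini cube.square_iso cube.Q_complete_push_probs
      cube.meas_maps_base cube.square_sets_Q_completion by blast
qed

end
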